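(* Let $\bar d\in\mathcal D(v,r;k_1,k_2)$ be an $\mathrm{ECD}(\bar\theta+1)$. If $d\in\mathcal D(v,r;k_1,k_2)$ is a design whose information matrix $C_d$ has a different multiset of eigenvalues from that of $C_{\bar d}$, then $\bar d$ is Schur-better than $d$ if and only if $\bar d$ is E-equivalent to or E-better than $d$, i.e. $z_{\bar d1}\ge z_{d1}$. Consequently, $\bar d$ is Schur-optimal if and only if it is E-optimal.
   Context: Let $k_1\ge k_2\ge 2$ be integers, $v=k_1+k_2$, and $2\le r\le v-1$. A resolvable design $d$ consists of $r$ replicates, each replicate being a partition of a fixed set of $v$ treatments into two blocks, one of size $k_1$ and one of size $k_2$ (if $k_1=k_2$, one block of each replicate is designated as "the block of size $k_1$"). Let $N_d$ be the $v\times 2r$ zero-one treatment/block incidence matrix, $D_s=\mathrm{Diag}(k_1,k_2,k_1,k_2,\dots,k_1,k_2)$ the diagonal matrix of block sizes, and $C_d=rI-N_dD_s^{-1}N_d'$ the information matrix. The design is connected if $C_d$ has rank $v-1$; only connected designs are considered, and $\mathcal D=\mathcal D(v,r;k_1,k_2)$ denotes the class of all of them. The nonzero eigenvalues of $C_d$ are $z_{d1}\le z_{d2}\le\dots\le z_{d,v-1}$. For $h\ne h'$, $\phi_{dhh'}$ is the number of treatments common to the blocks of size $k_1$ in replicates $h$ and $h'$. A design $d$ is an equal concurrence design $\mathrm{ECD}(\theta)$ if $\phi_{dhh'}=\theta$ for all $h\neq h'$. Put $\bar\theta=\lfloor k_1^2/(k_1+k_2)\rfloor$. The E-criterion is $1/z_{d1}$,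 to be minimized; a design is E-optimal if it maximizes $z_{d1}$ over $\mathcal D$. For convex $f:(0,\infty)\to\mathbb R$ let $\psi_f(d)=\sum_{i=1}^{v-1}f(z_{di})$. Design $d_1$ is Schur-better than $d_2$ if $\psi_f(d_1)\le\psi_f(d_2)$ for all convex $f$, with strict inequality for at least one $f$. A design is Schur-optimal if it minimizes $\psi_f$ over $\mathcal D$ for every convex $f$. *)

theory Defs
  imports
    "HOL-Analysis.Convex"
    "Jordan_Normal_Form.Char_Poly"
    "Jordan_Normal_Form.DL_Rank"
begin

(* The treatments are 0, ..., k1 + k2 - 1 and the replicates 0, ..., r - 1.  A design maps each
   replicate to the pair (block of size k1, block of size k2), so that for k1 = k2 the order of the
   pair designates "the block of size k1".  Values at indices >= r are irrelevant. *)
type_synonym design = "nat \<Rightarrow> nat set \<times> nat set"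

definition is_replicate :: "nat \<Rightarrow> nat \<Rightarrow> nat set \<times> nat set \<Rightarrow> bool" where
  "is_replicate k1 k2 p \<longleftrightarrow>
     fst p \<union> snd p = {..<k1 + k2} \<and> fst p \<inter> snd p = {} \<and> card (fst p) = k1 \<and> card (snd p) = k2"

definition resolvable_design :: "nat \<Rightarrow> nat \<Rightarrow> nat \<Rightarrow> design \<Rightarrow> bool" where
  "resolvable_design k1 k2 r d \<longleftrightarrow> (\<forall>h<r. is_replicate k1 k2 (d h))"

(* Column j belongs to replicate j div 2; even columns are the blocks of size k1. *)
definition block :: "design \<Rightarrow> nat \<Rightarrow> nat set" where
  "block d j = (if even j then fst (d (j div 2)) else snd (d (j div 2)))"

definition incidence_mat :: "nat \<Rightarrow> nat \<Rightarrow> nat \<Rightarrow> design \<Rightarrow> real mat" where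
  "incidence_mat k1 k2 r d =
     mat (k1 + k2) (2 * r) (\<lambda>(t, j). if t \<in> block d j then 1 else 0)"

definition block_size :: "nat \<Rightarrow> nat \<Rightarrow> nat \<Rightarrow> real" where
  "block_size k1 k2 j = (if even j then real k1 else real k2)"

definition size_mat :: "nat \<Rightarrow> nat \<Rightarrow> nat \<Rightarrow> real mat" where
  "size_mat k1 k2 r = mat_diag (2 * r) (block_size k1 k2)"

definition size_mat_inv :: "nat \<Rightarrow> nat \<Rightarrow> nat \<Rightarrow> real mat" where
  "size_mat_inv k1 k2 r = mat_diag (2 * r) (\<lambda>j. inverse (block_size k1 k2 j))"

lemma size_mat_inv:
  assumes "k1 > 0" "k2 > 0"
  shows "inverts_mat (size_mat k1 k2 r) (size_mat_inv k1 k2 r)"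
    and "inverts_mat (size_mat_inv k1 k2 r) (size_mat k1 k2 r)"
proof -
  have nz: "block_size k1 k2 j \<noteq> 0" for j
    using assms by (simp add: block_size_def)
  show "inverts_mat (size_mat k1 k2 r) (size_mat_inv k1 k2 r)"
    "inverts_mat (size_mat_inv k1 k2 r) (size_mat k1 k2 r)"
    unfolding inverts_mat_def size_mat_def size_mat_inv_def mat_diag_diag
    using nz by (auto simp: mat_diag_def)
qed

definition information_mat :: "nat \<Rightarrow> nat \<Rightarrow> nat \<Rightarrow> design \<Rightarrow> real mat" where
  "information_mat k1 k2 r d =
     real r \<cdot>\<^sub>m 1\<^sub>m (k1 + k2) -
     incidence_mat k1 k2 r d * size_mat_inv k1 k2 r * transpose_mat (incidence_mat k1 k2 r d)"

definition connected_design :: "nat \<Rightarrow> nat \<Rightarrow> nat \<Rightarrow> design \<Rightarrow> bool" where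
  "connected_design k1 k2 r d \<longleftrightarrow>
     vec_space.rank (k1 + k2) (information_mat k1 k2 r d) = k1 + k2 - 1"

definition designs :: "nat \<Rightarrow> nat \<Rightarrow> nat \<Rightarrow> design set" where
  "designs k1 k2 r = {d. resolvable_design k1 k2 r d \<and> connected_design k1 k2 r d}"

(* Eigenvalues with multiplicity.  Information matrices are real symmetric, so all their
   eigenvalues are real and algebraic and geometric multiplicities agree. *)
definition eigenvalue_mset :: "nat \<Rightarrow> nat \<Rightarrow> nat \<Rightarrow> design \<Rightarrow> real multiset" where
  "eigenvalue_mset k1 k2 r d = proots (char_poly (information_mat k1 k2 r d))"

(* nz_eig k1 k2 r d i is the i-th smallest nonzero eigenvalue, with i = 1, ..., k1 + k2 - 1. *)
definition nz_eig :: "nat \<Rightarrow> nat \<Rightarrow> nat \<Rightarrow> design \<Rightarrow> nat \<Rightarrow> real" where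
  "nz_eig k1 k2 r d i =
     sorted_list_of_multiset (filter_mset (\<lambda>x. x \<noteq> 0) (eigenvalue_mset k1 k2 r d)) ! (i - 1)"

definition concurrence :: "design \<Rightarrow> nat \<Rightarrow> nat \<Rightarrow> nat" where
  "concurrence d h h' = card (fst (d h) \<inter> fst (d h'))"

definition ECD :: "nat \<Rightarrow> nat \<Rightarrow> design \<Rightarrow> bool" where
  "ECD r \<theta> d \<longleftrightarrow> (\<forall>h<r. \<forall>h'<r. h \<noteq> h' \<longrightarrow> concurrence d h h' = \<theta>)"

definition theta_bar :: "nat \<Rightarrow> nat \<Rightarrow> nat" where
  "theta_bar k1 k2 = nat \<lfloor>real (k1\<^sup>2) / real (k1 + k2)\<rfloor>"

definition E_criterion :: "nat \<Rightarrow> nat \<Rightarrow> nat \<Rightarrow> design \<Rightarrow> real" where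
  "E_criterion k1 k2 r d = 1 / nz_eig k1 k2 r d 1"

definition E_better :: "nat \<Rightarrow> nat \<Rightarrow> nat \<Rightarrow> design \<Rightarrow> design \<Rightarrow> bool" where
  "E_better k1 k2 r d1 d2 \<longleftrightarrow> E_criterion k1 k2 r d1 < E_criterion k1 k2 r d2"

definition E_equivalent :: "nat \<Rightarrow> nat \<Rightarrow> nat \<Rightarrow> design \<Rightarrow> design \<Rightarrow> bool" where
  "E_equivalent k1 k2 r d1 d2 \<longleftrightarrow> E_criterion k1 k2 r d1 = E_criterion k1 k2 r d2"

definition E_optimal :: "nat \<Rightarrow> nat \<Rightarrow> nat \<Rightarrow> design \<Rightarrow> bool" where
  "E_optimal k1 k2 r d \<longleftrightarrow>
     d \<in> designs k1 k2 r \<and> (\<forall>d'\<in>designs k1 k2 r. nz_eig k1 k2 r d' 1 \<le> nz_eig k1 k2 r d 1)"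

definition psi :: "nat \<Rightarrow> nat \<Rightarrow> nat \<Rightarrow> (real \<Rightarrow> real) \<Rightarrow> design \<Rightarrow> real" where
  "psi k1 k2 r f d = (\<Sum>i = 1..k1 + k2 - 1. f (nz_eig k1 k2 r d i))"

definition Schur_better :: "nat \<Rightarrow> nat \<Rightarrow> nat \<Rightarrow> design \<Rightarrow> design \<Rightarrow> bool" where
  "Schur_better k1 k2 r d1 d2 \<longleftrightarrow>
     (\<forall>f. convex_on {0<..} f \<longrightarrow> psi k1 k2 r f d1 \<le> psi k1 k2 r f d2) \<and>
     (\<exists>f. convex_on {0<..} f \<and> psi k1 k2 r f d1 < psi k1 k2 r f d2)"

definition Schur_optimal :: "nat \<Rightarrow> nat \<Rightarrow> nat \<Rightarrow> design \<Rightarrow> bool" where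
  "Schur_optimal k1 k2 r d \<longleftrightarrow>
     d \<in> designs k1 k2 r \<and>
     (\<forall>f. convex_on {0<..} f \<longrightarrow> (\<forall>d'\<in>designs k1 k2 r. psi k1 k2 r f d \<le> psi k1 k2 r f d'))"

end

theory Submission
  imports Defs "Jordan_Normal_Form.Schur_Decomposition"
begin

text \<open>Let \<open>v = k1 + k2\<close>.  Within each replicate the two block indicators span the same plane as the
  all-ones vector and one unit vector orthogonal to it, the normalised centred indicator of the
  block of size \<open>k1\<close>.  Hence, on the complement of the all-ones vector, the information matrix is
  \<open>r I - W W'\<close>, where the columns of \<open>W\<close> are \<open>r\<close> unit vectors.  As \<open>W W'\<close> and the
  \<open>r \<times> r\<close> Gram matrix \<open>W' W\<close> have the same non-zero eigenvalues, the non-zero eigenvalues of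
  every connected design are \<open>r\<close> with multiplicity \<open>v - 1 - r\<close> and the \<open>r\<close> eigenvalues of
  \<open>r I - W' W\<close> (\<open>eigenvalue_mset_eq\<close>).  The latter, called dual eigenvalues below, are positive,
  at most \<open>r\<close>, and have total \<open>r (r - 1)\<close>.

  The entries of \<open>W' W\<close> are affine functions of the concurrences.  For an equal concurrence
  design all off-diagonal entries are the same number \<open>c\<close>, and the dual eigenvalues are
  \<open>p = (r - 1) (1 - c)\<close>, once, and \<open>q = r - 1 + c\<close>, \<open>r - 1\<close> times
  (\<open>ECD_dual_eigenvalues\<close>).  With the concurrence rounded up as in the theorem, \<open>c\<close> is positive
  and \<open>p\<close> is the least eigenvalue.

  If the least eigenvalue \<open>z\<close> of another design satisfies \<open>z \<le> p\<close>, then its dual eigenvalues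
  majorize \<open>p, q, ..., q\<close>: the least one is at most \<open>p\<close>, the totals agree, and on the other side all
  remaining values are equal.  So no convex function has a larger sum on the equal
  concurrence design (\<open>convex_sum_mset_le_of_lower_least\<close>), and the square has a strictly
  smaller one if the spectra differ (\<open>square_sum_mset_less_of_lower_least\<close>).  Conversely, the
  convex functions \<open>max 0 (a - x)\<close> detect the least eigenvalue (\<open>psi_le_imp_nz_eig_1_ge\<close>).\<close>

text \<open>From here on \<open>\<bullet>\<close> stands for the scalar product of vectors of explicit dimension only.\<close>

unbundle no inner_syntax

section \<open>Spectra of products and of symmetric real matrices\<close>

text \<open>Both sides are determinants of triangularised versions of the block matrix
  with rows \<open>(y I, -A)\<close> and \<open>(B, I)\<close>: clearing the lower left block from the right leaves
  \<open>y I + A B\<close>, clearing it from the left leaves \<open>y I + B A\<close>.  The left clearing has to scale the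
  lower rows by \<open>y\<close>, which need not be invertible; this is where the power \<open>y ^ m\<close> comes from.\<close>
lemma det_scalar_plus_product_swap:
  fixes A B :: "'a :: idom mat"
  assumes A: "A \<in> carrier_mat n m" and B: "B \<in> carrier_mat m n"
  shows "det (y \<cdot>\<^sub>m 1\<^sub>m n + A * B) * y ^ m = y ^ n * det (y \<cdot>\<^sub>m 1\<^sub>m m + B * A)"
proof -
  define M where "M = four_block_mat (y \<cdot>\<^sub>m 1\<^sub>m n) (- A) B (1\<^sub>m m)"
  define L where "L = four_block_mat (1\<^sub>m n) (0\<^sub>m n m) (- B) (y \<cdot>\<^sub>m 1\<^sub>m m)"
  define R where "R = four_block_mat (1\<^sub>m n) (0\<^sub>m n m) (- B) (1\<^sub>m m)"
  have car: "M \<in> carrier_mat (n + m) (n + m)" "L \<in> carrier_mat (n + m) (n + m)"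
      "R \<in> carrier_mat (n + m) (n + m)"
    unfolding M_def L_def R_def by auto
  have "M * R = four_block_mat (y \<cdot>\<^sub>m 1\<^sub>m n * 1\<^sub>m n + - A * - B) (y \<cdot>\<^sub>m 1\<^sub>m n * 0\<^sub>m n m + - A * 1\<^sub>m m)
      (B * 1\<^sub>m n + 1\<^sub>m m * - B) (B * 0\<^sub>m n m + 1\<^sub>m m * 1\<^sub>m m)"
    unfolding M_def R_def using A B by (subst mult_four_block_mat) auto
  also have "\<dots> = four_block_mat (y \<cdot>\<^sub>m 1\<^sub>m n + A * B) (- A) (0\<^sub>m m n) (1\<^sub>m m)"
    using A B by (intro cong_four_block_mat) auto
  finally have MR: "M * R = \<dots>" .
  have "L * M = four_block_mat (1\<^sub>m n * (y \<cdot>\<^sub>m 1\<^sub>m n) + 0\<^sub>m n m * B) (1\<^sub>m n * - A + 0\<^sub>m n m * 1\<^sub>m m)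
      (- B * (y \<cdot>\<^sub>m 1\<^sub>m n) + (y \<cdot>\<^sub>m 1\<^sub>m m) * B) (- B * - A + (y \<cdot>\<^sub>m 1\<^sub>m m) * 1\<^sub>m m)"
    unfolding M_def L_def using A B by (subst mult_four_block_mat) auto
  also have "\<dots> = four_block_mat (y \<cdot>\<^sub>m 1\<^sub>m n) (- A) (0\<^sub>m m n) (y \<cdot>\<^sub>m 1\<^sub>m m + B * A)"
    using A B
    by (intro cong_four_block_mat)
      (auto simp: mult_smult_distrib[of _ m n] mult_smult_assoc_mat[of _ m m _ n] comm_add_mat[of _ m m])
  finally have LM: "L * M = \<dots>" .
  have "det M = det (M * R)"
    using car A B unfolding R_def
    by (subst det_mult[of _ "n + m"]) (auto simp: det_four_block_mat_upper_right_zero[of _ n _ m])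
  also have "\<dots> = det (y \<cdot>\<^sub>m 1\<^sub>m n + A * B)"
    unfolding MR using A B by (subst det_four_block_mat_lower_left_zero[of _ n _ m]) auto
  finally have 1: "det M = \<dots>" .
  have "y ^ m * det M = det (L * M)"
    using car A B unfolding L_def
    by (subst det_mult[of _ "n + m"]) (auto simp: det_four_block_mat_upper_right_zero[of _ n _ m])
  also have "\<dots> = y ^ n * det (y \<cdot>\<^sub>m 1\<^sub>m m + B * A)"
    unfolding LM using A B by (subst det_four_block_mat_lower_left_zero[of _ n _ m]) auto
  finally show ?thesis
    using 1 by (simp add: mult.commute)
qed

text \<open>The previous identity over the polynomial ring with \<open>y = X - c\<close>.  It replaces the spectrum of
  a large matrix of the form \<open>c I - A B\<close> by that of a smaller one, at the price of eigenvalues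
  \<open>c\<close>.\<close>
lemma char_poly_scalar_minus_product_swap:
  fixes A B :: "'a :: idom mat"
  assumes A: "A \<in> carrier_mat n m" and B: "B \<in> carrier_mat m n"
  shows "char_poly (c \<cdot>\<^sub>m 1\<^sub>m n - A * B) * [:- c, 1:] ^ m =
    [:- c, 1:] ^ n * char_poly (c \<cdot>\<^sub>m 1\<^sub>m m - B * A)"
proof -
  let ?l = "map_mat (\<lambda>a :: 'a. [:a:])"
  have cp: "char_poly (c \<cdot>\<^sub>m 1\<^sub>m k - P * Q) = det ([:- c, 1:] \<cdot>\<^sub>m 1\<^sub>m k + ?l P * ?l Q)"
    if "P \<in> carrier_mat k l" "Q \<in> carrier_mat l k" for P Q :: "'a mat" and k l
  proof -
    have "char_poly_matrix (c \<cdot>\<^sub>m 1\<^sub>m k - P * Q) = [:- c, 1:] \<cdot>\<^sub>m 1\<^sub>m k + ?l (P * Q)"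
      using that by (intro eq_matI) (auto simp: char_poly_matrix_def)
    then show ?thesis
      using that by (simp add: char_poly_def map_poly_mult(1))
  qed
  show ?thesis
    unfolding cp[OF A B] cp[OF B A]
    using A B by (intro det_scalar_plus_product_swap) auto
qed

text \<open>Over the complex numbers the characteristic polynomial splits.  If \<open>A x = a x\<close>, then
  \<open>a |x|^2 = x* A x\<close>, and the right-hand side is its own conjugate because \<open>A\<close> is real and
  symmetric; hence every root \<open>a\<close> is real.\<close>
lemma symmetric_real_char_poly_splits:
  fixes A :: "real mat"
  assumes A: "A \<in> carrier_mat n n" and sym: "transpose_mat A = A"
  shows "\<exists>es. char_poly A = (\<Prod>e\<leftarrow>es. [:- e, 1:]) \<and> length es = n"
proof -
  let ?C = "map_mat complex_of_real A"
  have C: "?C \<in> carrier_mat n n" using A by simp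
  obtain as where as: "char_poly ?C = (\<Prod>a\<leftarrow>as. [:- a, 1:])" "length as = n"
    using char_poly_factorized[OF C] by blast
  have real: "complex_of_real (Re a) = a" if "a \<in> set as" for a
  proof -
    have "poly (char_poly ?C) a = 0"
      unfolding as poly_prod_list using that by (auto simp: prod_list_zero_iff)
    then obtain x where x: "x \<in> carrier_vec n" "x \<noteq> 0\<^sub>v n" "?C *\<^sub>v x = a \<cdot>\<^sub>v x"
      using eigenvalue_root_char_poly[OF C] C by (auto simp: eigenvalue_def eigenvector_def)
    have row: "(\<Sum>j<n. of_real (A $$ (i, j)) * x $ j) = a * x $ i" if "i < n" for i
      using arg_cong[OF x(3), of "\<lambda>w. w $ i"] that x(1) A
      by (simp add: scalar_prod_def lessThan_atLeast0)
    have symij: "A $$ (i, j) = A $$ (j, i)" if "i < n" "j < n" for i j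
      using arg_cong[OF sym, of "\<lambda>M. M $$ (i, j)"] that A by auto
    let ?N = "\<Sum>i<n. cnj (x $ i) * x $ i"
    have 1: "a * ?N = (\<Sum>i<n. \<Sum>j<n. of_real (A $$ (i, j)) * cnj (x $ i) * x $ j)"
      unfolding sum_distrib_left
    proof (rule sum.cong[OF refl])
      fix i assume "i \<in> {..<n}"
      then have "a * (cnj (x $ i) * x $ i) = cnj (x $ i) * (\<Sum>j<n. of_real (A $$ (i, j)) * x $ j)"
        using row[of i] by simp
      then show "a * (cnj (x $ i) * x $ i) = (\<Sum>j<n. of_real (A $$ (i, j)) * cnj (x $ i) * x $ j)"
        by (simp add: sum_distrib_left mult_ac)
    qed
    have "cnj (a * ?N) = (\<Sum>i<n. \<Sum>j<n. of_real (A $$ (i, j)) * x $ i * cnj (x $ j))"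
      unfolding 1 by simp
    also have "\<dots> = (\<Sum>j<n. \<Sum>i<n. of_real (A $$ (i, j)) * x $ i * cnj (x $ j))"
      by (rule sum.swap)
    also have "\<dots> = a * ?N"
      unfolding 1 by (intro sum.cong refl) (simp add: symij mult_ac)
    finally have "cnj a * cnj ?N = a * ?N" by simp
    moreover have "cnj ?N = ?N" by (simp add: mult.commute)
    moreover have "?N \<noteq> 0"
    proof
      assume "?N = 0"
      moreover have "?N = of_real (\<Sum>i<n. (cmod (x $ i))\<^sup>2)"
        by (simp add: complex_norm_square mult.commute del: of_real_power)
      ultimately have "(\<Sum>i<n. (cmod (x $ i))\<^sup>2) = 0" by (metis of_real_eq_0_iff)
      then have "\<forall>i<n. x $ i = 0" by (subst (asm) sum_nonneg_eq_0_iff) auto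
      then have "x = 0\<^sub>v n" using x(1) by (intro eq_vecI) auto
      then show False using x(2) by simp
    qed
    ultimately have "cnj a = a" by simp
    then show ?thesis by (metis Reals_cnj_iff of_real_Re)
  qed
  have "map_poly complex_of_real (char_poly A) = (\<Prod>a\<leftarrow>as. [:- a, 1:])"
    using as(1) by (simp add: of_real_hom.char_poly_hom[OF A])
  also have "\<dots> = (\<Prod>a\<leftarrow>as. map_poly complex_of_real [:- Re a, 1:])"
    using real by (intro arg_cong[where f = prod_list] map_cong) auto
  also have "\<dots> = map_poly complex_of_real (\<Prod>e\<leftarrow>map Re as. [:- e, 1:])"
  proof -
    interpret map_poly_comm_ring_hom complex_of_real ..
    show ?thesis by (simp add: hom_prod_list o_def)
  qed
  finally have "char_poly A = (\<Prod>e\<leftarrow>map Re as. [:- e, 1:])"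
    by (simp add: poly_eq_iff coeff_map_poly)
  then show ?thesis using as(2) by (intro exI[of _ "map Re as"]) simp
qed

text \<open>The trace is invariant under similarity, and a matrix whose characteristic polynomial splits is
  similar to a triangular one with the eigenvalues on the diagonal.\<close>
lemma trace_eq_sum_eigenvalues:
  fixes A :: "real mat"
  assumes A: "A \<in> carrier_mat n n" and es: "char_poly A = (\<Prod>e\<leftarrow>es. [:- e, 1:])"
  shows "(\<Sum>i<n. A $$ (i, i)) = sum_list es"
proof -
  obtain B P Q where dec: "schur_decomposition A es = (B, P, Q)" by (cases "schur_decomposition A es")
  have sim: "similar_mat_wit A B P Q" and diag: "diag_mat B = es"
    using schur_decomposition[OF A es dec] by auto
  have car: "B \<in> carrier_mat n n" "P \<in> carrier_mat n n" "Q \<in> carrier_mat n n"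
    and QP: "Q * P = 1\<^sub>m n" and APBQ: "A = P * B * Q"
    using sim A unfolding similar_mat_wit_def Let_def by auto
  have swap: "(\<Sum>i<n. (X * Y) $$ (i, i)) = (\<Sum>i<n. (Y * X) $$ (i, i))"
    if "X \<in> carrier_mat n n" "Y \<in> carrier_mat n n" for X Y :: "real mat"
    using that sum.swap[of "\<lambda>i j. X $$ (i, j) * Y $$ (j, i)" "{..<n}" "{..<n}"]
    by (simp add: scalar_prod_def lessThan_atLeast0 mult.commute)
  have "(\<Sum>i<n. A $$ (i, i)) = (\<Sum>i<n. (Q * (P * B)) $$ (i, i))"
    unfolding APBQ using car by (intro swap) auto
  also have "Q * (P * B) = B"
    using car QP by (simp add: assoc_mult_mat[symmetric, of _ n n _ n _ n])
  also have "(\<Sum>i<n. B $$ (i, i)) = sum_list es"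
    using car diag by (auto simp: diag_mat_def sum_list_sum_nth lessThan_atLeast0)
  finally show ?thesis .
qed

section \<open>Symmetric matrices of corank one\<close>

text \<open>The kernel of a symmetric matrix is orthogonal to its columns.  If \<open>x\<close> and \<open>y\<close> were two
  non-zero orthogonal kernel vectors, then \<open>n - 1\<close> independent columns together with \<open>x\<close>
  would form a square matrix whose columns are all orthogonal to \<open>y\<close>.  That matrix is singular,
  and pairing a linear dependency of its columns with \<open>x\<close> shows that \<open>x\<close> does not take part in
  it, which contradicts the independence of the other columns.\<close>
lemma rank_eq_pred_imp_kernel_line:
  fixes A :: "real mat"
  assumes A: "A \<in> carrier_mat n n" and sym: "transpose_mat A = A"
    and rank: "vec_space.rank n A = n - 1" and n: "0 < n"
    and x: "x \<in> carrier_vec n" "A *\<^sub>v x = 0\<^sub>v n" "x \<noteq> 0\<^sub>v n"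
    and y: "y \<in> carrier_vec n" "A *\<^sub>v y = 0\<^sub>v n" and xy: "x \<bullet> y = 0"
  shows "y = 0\<^sub>v n"
proof (rule ccontr)
  assume y0: "y \<noteq> 0\<^sub>v n"
  interpret vec_space "TYPE(real)" n .
  obtain S where S: "maximal S (\<lambda>T. T \<subseteq> set (cols A) \<and> lin_indpt T)"
    using maximal_exists_superset[of "set (cols A)" "\<lambda>T. T \<subseteq> set (cols A) \<and> lin_indpt T" "{}"]
    by (auto simp: lin_dep_def)
  then have SA: "S \<subseteq> set (cols A)" and indep: "lin_indpt S"
    by (auto simp: maximal_def)
  have cardS: "card S = n - 1"
    using rank_card_indpt[OF A S] rank by simp
  have fin: "finite S" using SA finite_subset by blast
  obtain ss where ss: "set ss = S" "distinct ss" "length ss = n - 1"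
    using finite_distinct_list[OF fin] cardS by (metis distinct_card)
  have car: "s \<in> carrier_vec n" if "s \<in> S" for s
    using that SA A cols_dim by blast
  have orth: "s \<bullet> w = 0" if s: "s \<in> S" and w: "w \<in> carrier_vec n" "A *\<^sub>v w = 0\<^sub>v n" for s w
  proof -
    obtain i where i: "i < n" "s = col A i"
      using s SA A by (auto simp: cols_def)
    have "s = row A i"
      using i A sym by (metis carrier_matD(2) row_transpose)
    then show ?thesis
      using arg_cong[OF w(2), of "\<lambda>v. v $ i"] i A by simp
  qed
  \<comment> \<open>This square matrix is singular because all its columns are orthogonal to \<open>y\<close>.\<close>
  define B where "B = mat_of_cols n (ss @ [x])"
  have B: "B \<in> carrier_mat n n" unfolding B_def using ss n by auto
  have rowBT: "row (transpose_mat B) i = (ss @ [x]) ! i" if "i < n" for i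
    unfolding B_def using that ss n car x(1) nth_mem[of i ss]
    by (subst row_transpose) (auto simp: nth_append intro!: col_mat_of_cols)
  have "transpose_mat B *\<^sub>v y = 0\<^sub>v n"
  proof (rule eq_vecI)
    fix i assume "i < dim_vec (0\<^sub>v n :: real vec)"
    then have i: "i < n" by simp
    have "(ss @ [x]) ! i \<bullet> y = 0"
      using i ss orth[OF _ y] xy nth_mem[of i ss] by (auto simp: nth_append)
    then show "(transpose_mat B *\<^sub>v y) $ i = 0\<^sub>v n $ i"
      using i B rowBT by simp
  qed (use B in auto)
  then have "det (transpose_mat B) = 0"
    using y(1) y0 B by (subst det_0_iff_vec_prod_zero_field[of _ n]) auto
  then have "det B = 0" using det_transpose[OF B] by simp
  then obtain w where w: "w \<in> carrier_vec n" "w \<noteq> 0\<^sub>v n" "B *\<^sub>v w = 0\<^sub>v n"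
    using det_0_iff_vec_prod_zero_field[OF B] by auto
  have Bij: "B $$ (i, j) = (ss @ [x]) ! j $ i" if "i < n" "j < n" for i j
    unfolding B_def using that ss by (simp add: mat_of_cols_def)
  have comb: "(\<Sum>j<n. (ss @ [x]) ! j $ i * w $ j) = 0" if "i < n" for i
    using arg_cong[OF w(3), of "\<lambda>v. v $ i"] that w(1) B Bij
    by (simp add: scalar_prod_def lessThan_atLeast0)
  have split: "(\<Sum>j<n. g j) = (\<Sum>j<n - 1. g j) + g (n - 1)" for g :: "nat \<Rightarrow> real"
    using n by (metis Suc_diff_1 sum.lessThan_Suc)
  have comb': "(\<Sum>j<n - 1. ss ! j $ i * w $ j) + x $ i * w $ (n - 1) = 0" if "i < n" for i
  proof -
    have "(\<Sum>j<n - 1. (ss @ [x]) ! j $ i * w $ j) = (\<Sum>j<n - 1. ss ! j $ i * w $ j)"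
      using ss by (intro sum.cong) (auto simp: nth_append)
    moreover have "(ss @ [x]) ! (n - 1) = x" using ss by (simp add: nth_append)
    ultimately show ?thesis using comb[OF that] by (simp add: split)
  qed
  \<comment> \<open>Pair the dependency with \<open>x\<close>, which is orthogonal to all vectors in \<open>ss\<close>.\<close>
  have last: "w $ (n - 1) = 0"
  proof -
    have "0 = (\<Sum>i<n. x $ i * ((\<Sum>j<n - 1. ss ! j $ i * w $ j) + x $ i * w $ (n - 1)))"
      using comb' by simp
    also have "\<dots> = (\<Sum>i<n. \<Sum>j<n - 1. x $ i * (ss ! j $ i * w $ j)) + (\<Sum>i<n. x $ i * x $ i) * w $ (n - 1)"
      by (simp add: distrib_left sum.distrib sum_distrib_left sum_distrib_right mult.assoc)
    also have "(\<Sum>i<n. \<Sum>j<n - 1. x $ i * (ss ! j $ i * w $ j)) = (\<Sum>j<n - 1. (ss ! j \<bullet> x) * w $ j)"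
      using x(1) by (subst sum.swap)
        (simp add: scalar_prod_def lessThan_atLeast0 sum_distrib_left sum_distrib_right mult_ac)
    also have "\<dots> = 0"
      using ss orth[OF _ x(1,2)] by (intro sum.neutral) (metis lessThan_iff mult_zero_left nth_mem)
    finally have "(\<Sum>i<n. x $ i * x $ i) * w $ (n - 1) = 0" by simp
    moreover have "(\<Sum>i<n. x $ i * x $ i) \<noteq> 0"
    proof
      assume "(\<Sum>i<n. x $ i * x $ i) = 0"
      then have "\<forall>i<n. x $ i = 0" by (subst (asm) sum_nonneg_eq_0_iff) auto
      then show False using x(1,3) by (metis carrier_vecD eq_vecI index_zero_vec)
    qed
    ultimately show ?thesis by simp
  qed
  define u where "u = vec (n - 1) (\<lambda>j. w $ j)"
  have u0: "u \<noteq> 0\<^sub>v (n - 1)"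
  proof
    assume "u = 0\<^sub>v (n - 1)"
    then have "w $ j = 0" if "j < n - 1" for j
      using that unfolding u_def by (metis index_vec index_zero_vec(1))
    then have "w $ j = 0" if "j < n" for j
      using that last by (cases "j = n - 1") auto
    then show False using w(1,2) by (metis carrier_vecD eq_vecI index_zero_vec)
  qed
  have "mat_of_cols n ss *\<^sub>v u = 0\<^sub>v n"
  proof (rule eq_vecI)
    fix i assume "i < dim_vec (0\<^sub>v n :: real vec)"
    then show "(mat_of_cols n ss *\<^sub>v u) $ i = 0\<^sub>v n $ i"
      using comb'[of i] last ss
      by (simp add: u_def scalar_prod_def lessThan_atLeast0 mat_of_cols_def)
  qed auto
  moreover have "cols (mat_of_cols n ss) = ss"
    using car ss by (intro cols_mat_of_cols) auto
  ultimately have "lin_dep (set ss)"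
    using lin_depI[of "mat_of_cols n ss" "n - 1" u] u0 ss mat_of_cols_carrier(1)[of n ss] by (auto simp: u_def)
  then show False using indep ss by simp
qed

section \<open>Sums of convex functions\<close>

text \<open>The slopes of the chords ending at \<open>q\<close> increase, so those on the left of \<open>q\<close> are bounded by the
  infimum \<open>s\<close> of those on the right.\<close>
lemma convex_on_pos_supporting_line:
  fixes f :: "real \<Rightarrow> real"
  assumes f: "convex_on {0<..} f" and q: "0 < q"
  obtains s where "\<And>x. 0 < x \<Longrightarrow> f q + s * (x - q) \<le> f x"
proof -
  define slope where "slope x = (f x - f q) / (x - q)" for x
  define s where "s = Inf (slope ` {q<..})"
  have slopes: "slope a \<le> slope b" if "0 < a" "a < q" "q < b" for a b
    using convex_on_slope_le[OF f, of a b q] that q by (simp add: slope_def divide_simps algebra_simps)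
  have bdd: "bdd_below (slope ` {q<..})"
    using slopes[of "q / 2"] q by (intro bdd_belowI[of _ "slope (q / 2)"]) auto
  have above: "s \<le> slope b" if "q < b" for b
    unfolding s_def using that bdd by (intro cInf_lower) auto
  have below: "slope a \<le> s" if "0 < a" "a < q" for a
    unfolding s_def using slopes that by (intro cInf_greatest) (auto simp: gt_ex)
  have "f q + s * (x - q) \<le> f x" if "0 < x" for x
  proof (cases x q rule: linorder_cases)
    case less
    then show ?thesis using below[OF that less] by (simp add: slope_def divide_simps mult.commute)
  next
    case greater
    then show ?thesis using above[OF greater] by (simp add: slope_def divide_simps mult.commute)
  qed simp
  then show ?thesis by (rule that)
qed

text \<open>This is the instance of the majorization inequality that the theorem needs.  Take a supporting
  line of \<open>f\<close> at \<open>q\<close> with slope \<open>s\<close>.  Summed over \<open>N\<close> it gives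
  \<open>size N * f q + s * (p - z)\<close> as a lower bound for the sum of \<open>f\<close>, because the two multisets
  have the same total.  It remains to see that \<open>f p - f z \<le> s * (p - z)\<close>: the chords
  of \<open>f\<close> over subintervals of \<open>[z, q]\<close> that start at \<open>z\<close> have slope at most \<open>s\<close>.\<close>
lemma convex_sum_mset_le_of_lower_least:
  fixes f :: "real \<Rightarrow> real"
  assumes f: "convex_on {0<..} f" and z: "0 < z" "z \<le> p" "p \<le> q"
    and N: "\<And>x. x \<in># N \<Longrightarrow> 0 < x"
    and sum: "z + \<Sum>\<^sub># N = p + real (size N) * q"
  shows "f p + real (size N) * f q \<le> f z + (\<Sum>x\<in>#N. f x)"
proof -
  obtain s where s: "\<And>x. 0 < x \<Longrightarrow> f q + s * (x - q) \<le> f x"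
    using convex_on_pos_supporting_line[OF f, of q] z by auto
  have "real (size N) * f q + s * (\<Sum>\<^sub># N - real (size N) * q) \<le> (\<Sum>x\<in>#N. f x)"
    using N
  proof (induction N)
    case (add x N)
    then show ?case using s[of x] by (simp add: algebra_simps)
  qed simp
  moreover have "\<Sum>\<^sub># N - real (size N) * q = p - z" using sum by simp
  moreover have "f p \<le> f z + s * (p - z)"
  proof (cases "z = q")
    case False
    then have zq: "z < q" using z by simp
    define t where "t = (p - z) / (q - z)"
    have t: "0 \<le> t" "t \<le> 1" "t * (q - z) = p - z"
      using z zq by (auto simp: t_def)
    have pt: "p = (1 - t) *\<^sub>R z + t *\<^sub>R q"
      using t(3) by (simp add: algebra_simps)
    have "f p \<le> (1 - t) * f z + t * f q"
      unfolding pt using convex_onD[OF f t(1,2)] z by auto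
    also have "\<dots> = f z + t * (f q - f z)" by (simp add: algebra_simps)
    also have "\<dots> \<le> f z + t * (s * (q - z))"
      using s[of z] z t by (intro add_left_mono mult_left_mono) (simp_all add: algebra_simps)
    also have "t * (s * (q - z)) = s * (p - z)" using t(3) by (metis mult.left_commute)
    finally show ?thesis .
  qed (use z in simp)
  ultimately show ?thesis by simp
qed

text \<open>Under the same constraints the difference of the two sums of squares is
  \<open>(p - z) * (2 * q - p - z)\<close> plus the sum of \<open>(x - q)\<^sup>2\<close> over \<open>N\<close>.  It vanishes only if
  all elements of \<open>N\<close> equal \<open>q\<close>, and then the equality of the totals gives \<open>z = p\<close>.\<close>
lemma square_sum_mset_less_of_lower_least:
  fixes z p q :: real
  assumes z: "z \<le> p" "p \<le> q"
    and sum: "z + \<Sum>\<^sub># N = p + real (size N) * q"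
    and neq: "add_mset z N \<noteq> add_mset p (replicate_mset (size N) q)"
  shows "p\<^sup>2 + real (size N) * q\<^sup>2 < z\<^sup>2 + (\<Sum>x\<in>#N. x\<^sup>2)"
proof -
  have expand: "(\<Sum>x\<in>#N. (x - q)\<^sup>2) = (\<Sum>x\<in>#N. x\<^sup>2) - 2 * q * \<Sum>\<^sub># N + real (size N) * q\<^sup>2"
    by (induction N) (simp_all add: power2_eq_square algebra_simps)
  have gap: "z\<^sup>2 + (\<Sum>x\<in>#N. x\<^sup>2) - (p\<^sup>2 + real (size N) * q\<^sup>2) =
      (p - z) * ((q - p) + (q - z)) + (\<Sum>x\<in>#N. (x - q)\<^sup>2)"
  proof -
    have N: "\<Sum>\<^sub># N = p - z + real (size N) * q" using sum by simp
    show ?thesis unfolding expand N by (simp add: power2_eq_square algebra_simps)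
  qed
  have nonneg: "0 \<le> (p - z) * ((q - p) + (q - z))" using z by simp
  have "0 < (\<Sum>x\<in>#N. (x - q)\<^sup>2)" if ex: "\<exists>x\<in>#N. x \<noteq> q"
  proof -
    obtain x where "x \<in># N" and x: "x \<noteq> q" using ex by blast
    then obtain N' where "N = add_mset x N'" using multi_member_split by metis
    moreover have "0 \<le> (\<Sum>x\<in>#N'. (x - q)\<^sup>2)" by (induction N') auto
    ultimately show ?thesis using x by (simp add: add_pos_nonneg)
  qed
  moreover have "\<exists>x\<in>#N. x \<noteq> q"
  proof (rule ccontr)
    assume "\<not> ?thesis"
    then have N: "N = replicate_mset (size N) q" by (intro set_mset_subset_singletonD) auto
    have "\<Sum>\<^sub># N = real (size N) * q" by (subst N) simp
    then have "z = p" using sum by simp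
    then show False using neq N by simp
  qed
  ultimately show ?thesis using gap nonneg by linarith
qed

section \<open>The dual of the information matrix\<close>

text \<open>The projection of the indicator vector of the block of size \<open>k1\<close> onto the orthogonal
  complement of the all-ones vector.  For the other block the projection is the negative of this
  vector.\<close>
definition centred_indicator :: "nat \<Rightarrow> nat \<Rightarrow> design \<Rightarrow> nat \<Rightarrow> nat \<Rightarrow> real" where
  "centred_indicator k1 k2 d h t = of_bool (t \<in> fst (d h)) - real k1 / real (k1 + k2)"

text \<open>The factor makes the centred indicators unit vectors, so that this is the Gram matrix of \<open>r\<close>
  unit vectors.\<close>
definition replicate_gram :: "nat \<Rightarrow> nat \<Rightarrow> design \<Rightarrow> nat \<Rightarrow> nat \<Rightarrow> real" where
  "replicate_gram k1 k2 d h h' = real (k1 + k2) / (real k1 * real k2) *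
     (\<Sum>t<k1 + k2. centred_indicator k1 k2 d h t * centred_indicator k1 k2 d h' t)"

definition dual_information_mat :: "nat \<Rightarrow> nat \<Rightarrow> nat \<Rightarrow> design \<Rightarrow> real mat" where
  "dual_information_mat k1 k2 r d =
     real r \<cdot>\<^sub>m 1\<^sub>m r - mat r r (\<lambda>(h, h'). replicate_gram k1 k2 d h h')"

lemma dual_information_mat_carrier [simp]: "dual_information_mat k1 k2 r d \<in> carrier_mat r r"
  by (auto simp: dual_information_mat_def)

lemma dual_information_mat_dim [simp]:
  "dim_row (dual_information_mat k1 k2 r d) = r" "dim_col (dual_information_mat k1 k2 r d) = r"
  by (auto simp: dual_information_mat_def)

lemma replicate_gram_commute: "replicate_gram k1 k2 d h h' = replicate_gram k1 k2 d h' h"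
  by (simp add: replicate_gram_def mult.commute)

locale positive_sizes =
  fixes k1 k2 :: nat
  assumes k1_pos: "0 < k1" and k2_pos: "0 < k2"
begin

text \<open>The factor \<open>\<kappa>\<close> is the inverse of the squared length \<open>k1 * k2 / v\<close> of a centred indicator.\<close>

abbreviation "u \<equiv> centred_indicator k1 k2"
abbreviation "v \<equiv> k1 + k2"
abbreviation "\<kappa> \<equiv> real (k1 + k2) / (real k1 * real k2)"

lemma sum_block_indicator:
  assumes "is_replicate k1 k2 (d h)"
  shows "(\<Sum>t<v. of_bool (t \<in> fst (d h))) = real k1"
proof -
  have "{..<v} \<inter> {t. t \<in> fst (d h)} = fst (d h)" using assms by (auto simp: is_replicate_def)
  then show ?thesis using assms by (simp add: is_replicate_def)
qed

lemma sum_centred_indicator: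
  assumes "is_replicate k1 k2 (d h)"
  shows "(\<Sum>t<v. u d h t) = 0"
  using sum_block_indicator[of d h] assms k1_pos
  by (simp add: centred_indicator_def sum_subtractf)

lemma replicate_gram_eq_concurrence:
  assumes h: "is_replicate k1 k2 (d h)" and h': "is_replicate k1 k2 (d h')"
  shows "replicate_gram k1 k2 d h h' =
    (real v * real (concurrence d h h') - (real k1)\<^sup>2) / (real k1 * real k2)"
proof -
  have "{..<v} \<inter> {t. t \<in> fst (d h) \<and> t \<in> fst (d h')} = fst (d h) \<inter> fst (d h')"
    using h by (auto simp: is_replicate_def)
  then have "(\<Sum>t<v. of_bool (t \<in> fst (d h)) * of_bool (t \<in> fst (d h'))) = real (concurrence d h h')"
    by (simp add: concurrence_def flip: of_bool_conj)
  moreover have "(\<Sum>t<v. u d h t * u d h' t) =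
      (\<Sum>t<v. of_bool (t \<in> fst (d h)) * of_bool (t \<in> fst (d h')))
      - real k1 / real v * (\<Sum>t<v. of_bool (t \<in> fst (d h')))
      - real k1 / real v * (\<Sum>t<v. u d h t)"
    unfolding sum_distrib_left sum_subtractf[symmetric]
    by (intro sum.cong refl) (simp add: centred_indicator_def algebra_simps)
  ultimately have "(\<Sum>t<v. u d h t * u d h' t) =
      real (concurrence d h h') - real k1 / real v * real k1"
    using sum_block_indicator[of d h'] sum_centred_indicator[of d h] h h' by simp
  moreover have "\<kappa> * (real (concurrence d h h') - real k1 / real v * real k1) =
      (real v * real (concurrence d h h') - (real k1)\<^sup>2) / (real k1 * real k2)"
    using k1_pos k2_pos by (simp add: field_simps power2_eq_square del: of_nat_add)
  ultimately show ?thesis unfolding replicate_gram_def by simp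
qed

lemma replicate_gram_self:
  assumes "is_replicate k1 k2 (d h)"
  shows "replicate_gram k1 k2 d h h = 1"
proof -
  have "concurrence d h h = k1" using assms by (simp add: concurrence_def is_replicate_def)
  moreover have "real v * real k1 - (real k1)\<^sup>2 = real k1 * real k2"
    by (simp add: power2_eq_square algebra_simps)
  ultimately show ?thesis
    using replicate_gram_eq_concurrence[of d h h] assms k1_pos k2_pos by simp
qed

lemma information_mat_carrier [simp]: "information_mat k1 k2 r d \<in> carrier_mat v v"
  by (auto simp: information_mat_def incidence_mat_def size_mat_inv_def mat_diag_def)

lemma information_mat_dim [simp]:
  "dim_row (information_mat k1 k2 r d) = v" "dim_col (information_mat k1 k2 r d) = v"
  by (rule carrier_matD[OF information_mat_carrier])+

text \<open>For \<open>a, b \<in> {0, 1}\<close> the left-hand side is an entry of the orthogonal projection onto the span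
  of the two block indicators of a replicate, with block sizes \<open>x\<close> and \<open>y\<close>.  The right-hand side
  uses the orthogonal basis of that plane formed by the all-ones vector and the centred
  indicator.\<close>
lemma projection_split:
  fixes x y a b :: real
  assumes "0 < x" "0 < y"
  shows "a * b / x + (1 - a) * (1 - b) / y =
    1 / (x + y) + (x + y) / (x * y) * ((a - x / (x + y)) * (b - x / (x + y)))"
proof -
  have "x + y \<noteq> 0" "x \<noteq> 0" "y \<noteq> 0" using assms by auto
  then show ?thesis by (simp add: divide_simps) (simp add: algebra_simps)
qed

text \<open>Every replicate contributes the projection onto the constants, and the centred indicators
  contribute the rest: \<open>C = r (I - J / v) - \<kappa> \<Sum>h. u_h u_h'\<close>.\<close>
lemma information_mat_entry:
  assumes d: "resolvable_design k1 k2 r d" and st: "s < v" "t < v"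
  shows "information_mat k1 k2 r d $$ (s, t) =
    real r * of_bool (s = t) - (real r / real v + \<kappa> * (\<Sum>h<r. u d h s * u d h t))"
proof -
  have pairs: "(\<Sum>j<2 * r. g j) = (\<Sum>h<r. g (2 * h) + g (2 * h + 1))" for g :: "nat \<Rightarrow> real"
    by (induction r) auto
  have N: "(incidence_mat k1 k2 r d * size_mat_inv k1 k2 r) $$ (s, j) =
      of_bool (s \<in> block d j) * inverse (block_size k1 k2 j)" if "j < 2 * r" for j
  proof -
    have "(incidence_mat k1 k2 r d * size_mat_inv k1 k2 r) $$ (s, j) =
        (\<Sum>i<2 * r. of_bool (s \<in> block d i) * (if i = j then inverse (block_size k1 k2 j) else 0))"
      using that st
      by (simp add: incidence_mat_def size_mat_inv_def mat_diag_def scalar_prod_def lessThan_atLeast0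
          of_bool_def)
    also have "\<dots> = of_bool (s \<in> block d j) * inverse (block_size k1 k2 j)"
      using that by (simp add: if_distrib cong: if_cong)
    finally show ?thesis .
  qed
  have dims: "dim_row (incidence_mat k1 k2 r d) = v" "dim_col (incidence_mat k1 k2 r d) = 2 * r"
      "dim_row (size_mat_inv k1 k2 r) = 2 * r" "dim_col (size_mat_inv k1 k2 r) = 2 * r"
    by (auto simp: incidence_mat_def size_mat_inv_def mat_diag_def)
  have row: "(incidence_mat k1 k2 r d * size_mat_inv k1 k2 r * transpose_mat (incidence_mat k1 k2 r d)) $$ (s, t) =
      (\<Sum>j<2 * r. of_bool (s \<in> block d j) * inverse (block_size k1 k2 j) * of_bool (t \<in> block d j))"
  proof -
    have "(incidence_mat k1 k2 r d * size_mat_inv k1 k2 r * transpose_mat (incidence_mat k1 k2 r d)) $$ (s, t) =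
        (\<Sum>j<2 * r. (incidence_mat k1 k2 r d * size_mat_inv k1 k2 r) $$ (s, j) * incidence_mat k1 k2 r d $$ (t, j))"
      using st dims
      by (subst index_mult_mat) (auto simp: scalar_prod_def lessThan_atLeast0 simp del: index_mult_mat(1)
          intro!: sum.cong)
    also have "\<dots> = (\<Sum>j<2 * r. of_bool (s \<in> block d j) * inverse (block_size k1 k2 j) * of_bool (t \<in> block d j))"
      using N st by (intro sum.cong refl) (simp add: incidence_mat_def)
    finally show ?thesis .
  qed
  also have "\<dots> = (\<Sum>h<r. 1 / real v + \<kappa> * (u d h s * u d h t))"
    unfolding pairs
  proof (rule sum.cong[OF refl])
    fix h assume "h \<in> {..<r}"
    then have "is_replicate k1 k2 (d h)" using d by (simp add: resolvable_design_def)
    then have compl: "x \<in> snd (d h) \<longleftrightarrow> x \<notin> fst (d h)" if "x < v" for x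
      using that unfolding is_replicate_def by blast
    have "of_bool (s \<in> block d (2 * h)) * inverse (block_size k1 k2 (2 * h)) * of_bool (t \<in> block d (2 * h)) +
        of_bool (s \<in> block d (2 * h + 1)) * inverse (block_size k1 k2 (2 * h + 1)) * of_bool (t \<in> block d (2 * h + 1))
       = of_bool (s \<in> fst (d h)) * of_bool (t \<in> fst (d h)) / real k1
         + of_bool (s \<notin> fst (d h)) * of_bool (t \<notin> fst (d h)) / real k2"
      using compl st by (simp add: block_def block_size_def divide_inverse)
    also have "\<dots> = 1 / real v + \<kappa> * (u d h s * u d h t)"
      using k1_pos k2_pos
        projection_split[of "real k1" "real k2" "of_bool (s \<in> fst (d h))" "of_bool (t \<in> fst (d h))"]
      by (simp add: centred_indicator_def of_bool_not_iff)
    finally show "of_bool (s \<in> block d (2 * h)) * inverse (block_size k1 k2 (2 * h)) * of_bool (t \<in> block d (2 * h)) +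
        of_bool (s \<in> block d (2 * h + 1)) * inverse (block_size k1 k2 (2 * h + 1)) * of_bool (t \<in> block d (2 * h + 1))
       = 1 / real v + \<kappa> * (u d h s * u d h t)" .
  qed
  also have "\<dots> = real r / real v + \<kappa> * (\<Sum>h<r. u d h s * u d h t)"
    by (simp add: sum.distrib sum_distrib_left)
  finally show ?thesis
    using st dims by (simp add: information_mat_def of_bool_def)
qed

lemma transpose_information_mat:
  assumes "resolvable_design k1 k2 r d"
  shows "transpose_mat (information_mat k1 k2 r d) = information_mat k1 k2 r d"
proof (rule eq_matI)
  fix s t assume "s < dim_row (information_mat k1 k2 r d)" "t < dim_col (information_mat k1 k2 r d)"
  then have st: "s < v" "t < v" by simp_all
  have "(\<Sum>h<r. u d h t * u d h s) = (\<Sum>h<r. u d h s * u d h t)"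
    by (simp add: mult.commute)
  then show "transpose_mat (information_mat k1 k2 r d) $$ (s, t) = information_mat k1 k2 r d $$ (s, t)"
    using st by (auto simp: information_mat_entry[OF assms])
qed simp_all

text \<open>By the preceding formula \<open>C = r I - A B\<close>, where the columns of \<open>A\<close> and the rows of \<open>B\<close> are,
  up to factors, the all-ones vector and the \<open>r\<close> centred indicators.  As the latter are orthogonal
  to the former, \<open>B A\<close> is the block diagonal matrix of \<open>r\<close> and the Gram matrix.  The factors
  are put into \<open>A\<close> alone, so that no square roots appear.\<close>
lemma information_char_poly:
  assumes d: "resolvable_design k1 k2 r d"
  shows "char_poly (information_mat k1 k2 r d) * [:- real r, 1:] ^ Suc r =
    [:- real r, 1:] ^ v * ([:0, 1:] * char_poly (dual_information_mat k1 k2 r d))"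
proof -
  define A where "A = mat v (Suc r) (\<lambda>(t, j). case j of 0 \<Rightarrow> real r / real v | Suc h \<Rightarrow> \<kappa> * u d h t)"
  define B where "B = mat (Suc r) v (\<lambda>(j, t). case j of 0 \<Rightarrow> 1 | Suc h \<Rightarrow> u d h t)"
  have A: "A \<in> carrier_mat v (Suc r)" and B: "B \<in> carrier_mat (Suc r) v"
    by (auto simp: A_def B_def)
  have u0: "(\<Sum>t<v. u d h t) = 0" if "h < r" for h
    using that d by (intro sum_centred_indicator) (simp add: resolvable_design_def)
  have AB: "information_mat k1 k2 r d = real r \<cdot>\<^sub>m 1\<^sub>m v - A * B"
  proof (rule eq_matI)
    fix s t assume "s < dim_row (real r \<cdot>\<^sub>m 1\<^sub>m v - A * B)" "t < dim_col (real r \<cdot>\<^sub>m 1\<^sub>m v - A * B)"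
    then have st: "s < v" "t < v" using A B by auto
    have "(A * B) $$ (s, t) = (\<Sum>j<Suc r. A $$ (s, j) * B $$ (j, t))"
      using st A B by (simp add: scalar_prod_def lessThan_atLeast0)
    also have "\<dots> = real r / real v + \<kappa> * (\<Sum>h<r. u d h s * u d h t)"
      using st unfolding sum.lessThan_Suc_shift
      by (simp add: A_def B_def sum_distrib_left mult.assoc del: sum.lessThan_Suc of_nat_add)
    finally show "information_mat k1 k2 r d $$ (s, t) = (real r \<cdot>\<^sub>m 1\<^sub>m v - A * B) $$ (s, t)"
      using st A B by (simp add: information_mat_entry[OF d] of_bool_def del: index_mult_mat(1))
  qed (use A B in auto)
  have BA: "real r \<cdot>\<^sub>m 1\<^sub>m (Suc r) - B * A =
      four_block_mat (0\<^sub>m 1 1) (0\<^sub>m 1 r) (0\<^sub>m r 1) (dual_information_mat k1 k2 r d)" (is "?L = ?R")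
  proof (rule eq_matI)
    fix i j assume "i < dim_row ?R" "j < dim_col ?R"
    then have ij: "i < Suc r" "j < Suc r" by (auto simp: dual_information_mat_def)
    have ent: "(B * A) $$ (i, j) = (\<Sum>t<v. B $$ (i, t) * A $$ (t, j))"
      using ij A B by (simp add: scalar_prod_def lessThan_atLeast0 del: of_nat_add)
    have L: "?L $$ (i, j) = real r * of_bool (i = j) - (\<Sum>t<v. B $$ (i, t) * A $$ (t, j))"
      using ij A B unfolding ent[symmetric] by (simp del: index_mult_mat(1))
    show "?L $$ (i, j) = ?R $$ (i, j)"
    proof (cases i)
      case 0
      show ?thesis
      proof (cases j)
        case 0
        have "(\<Sum>t<v. B $$ (i, t) * A $$ (t, j)) = (\<Sum>t<v. real r / real v)"
          using 0 \<open>i = 0\<close> by (intro sum.cong refl) (simp add: A_def B_def)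
        also have "\<dots> = real r" using k1_pos by (simp del: of_nat_add)
        finally show ?thesis unfolding L using 0 \<open>i = 0\<close> by simp
      next
        case (Suc h)
        have "(\<Sum>t<v. B $$ (i, t) * A $$ (t, j)) = (\<Sum>t<v. \<kappa> * u d h t)"
          using 0 Suc ij by (intro sum.cong refl) (simp add: A_def B_def)
        also have "\<dots> = 0" using u0[of h] Suc ij unfolding sum_distrib_left[symmetric] by simp
        finally show ?thesis unfolding L using 0 Suc ij by simp
      qed
    next
      case (Suc h)
      show ?thesis
      proof (cases j)
        case 0
        have "(\<Sum>t<v. B $$ (i, t) * A $$ (t, j)) = (\<Sum>t<v. u d h t * (real r / real v))"
          using 0 Suc ij by (intro sum.cong refl) (simp add: A_def B_def)
        also have "\<dots> = 0" using u0[of h] Suc ij unfolding sum_distrib_right[symmetric] by simp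
        finally show ?thesis unfolding L using 0 Suc ij by simp
      next
        case (Suc h')
        have "(\<Sum>t<v. B $$ (i, t) * A $$ (t, j)) = (\<Sum>t<v. \<kappa> * (u d h t * u d h' t))"
          using Suc \<open>i = Suc h\<close> ij by (intro sum.cong refl) (simp add: A_def B_def)
        also have "\<dots> = replicate_gram k1 k2 d h h'"
          by (simp add: replicate_gram_def sum_distrib_left)
        finally show ?thesis
          unfolding L using Suc \<open>i = Suc h\<close> ij by (simp add: dual_information_mat_def)
      qed
    qed
  qed (use A B in \<open>auto simp: dual_information_mat_def\<close>)
  have "char_poly (real r \<cdot>\<^sub>m 1\<^sub>m (Suc r) - B * A) =
      char_poly (0\<^sub>m 1 1) * char_poly (dual_information_mat k1 k2 r d)"
    unfolding BA by (intro char_poly_four_block_zeros_col) auto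
  moreover have "char_poly (0\<^sub>m 1 1 :: real mat) = [:0, 1:]"
    by (subst char_poly_upper_triangular[of _ 1]) (auto simp: diag_mat_def upper_triangular_def)
  ultimately show ?thesis
    using char_poly_scalar_minus_product_swap[OF A B, of "real r"] unfolding AB by simp
qed

section \<open>The spectrum of a design\<close>

definition dual_eigenvalues :: "nat \<Rightarrow> design \<Rightarrow> real multiset" where
  "dual_eigenvalues r d = proots (char_poly (dual_information_mat k1 k2 r d))"

text \<open>The eigenvalue \<open>0\<close> belongs to the all-ones vector, and the additional eigenvalues \<open>r\<close> belong
  to vectors orthogonal to all blocks, a space of dimension at least \<open>v - 1 - r\<close>; the dual matrix
  accounts for the remaining ones.\<close>
lemma eigenvalue_mset_eq:
  assumes d: "resolvable_design k1 k2 r d" and r: "r < v"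
  shows "eigenvalue_mset k1 k2 r d =
    add_mset 0 (dual_eigenvalues r d + replicate_mset (v - 1 - r) (real r))"
proof -
  have monic: "char_poly M \<noteq> 0" if "M \<in> carrier_mat n n" for M :: "real mat" and n
    using degree_monic_char_poly[OF that] by auto
  have repeat: "repeat_mset n {#a#} = replicate_mset n a" for n and a :: real
    by (induction n) auto
  have "proots (char_poly (information_mat k1 k2 r d) * [:- real r, 1:] ^ Suc r) =
      proots ([:- real r, 1:] ^ v * ([:0, 1:] * char_poly (dual_information_mat k1 k2 r d)))"
    unfolding information_char_poly[OF d] ..
  then have "eigenvalue_mset k1 k2 r d + replicate_mset (Suc r) (real r) =
      replicate_mset v (real r) + add_mset 0 (dual_eigenvalues r d)"
    using monic[OF information_mat_carrier[of r d]] monic[OF dual_information_mat_carrier[of k1 k2 r d]]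
    by (simp add: proots_mult proots_power repeat eigenvalue_mset_def dual_eigenvalues_def
        del: power_Suc mult_pCons_left mult_pCons_right)
  also have "replicate_mset v (real r) =
      replicate_mset (v - 1 - r) (real r) + replicate_mset (Suc r) (real r)"
    using r by (intro multiset_eqI) auto
  finally show ?thesis by (simp add: ac_simps del: replicate_mset_Suc)
qed

lemma dual_mult_vec:
  assumes x: "x \<in> carrier_vec r" and h: "h < r"
  shows "(dual_information_mat k1 k2 r d *\<^sub>v x) $ h =
    real r * x $ h - (\<Sum>h'<r. replicate_gram k1 k2 d h h' * x $ h')"
proof -
  have "(dual_information_mat k1 k2 r d *\<^sub>v x) $ h =
      (\<Sum>h'<r. real r * of_bool (h = h') * x $ h' - replicate_gram k1 k2 d h h' * x $ h')"
    using x h by (simp add: scalar_prod_def lessThan_atLeast0)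
      (intro sum.cong, auto simp: dual_information_mat_def algebra_simps)
  also have "\<dots> = real r * x $ h - (\<Sum>h'<r. replicate_gram k1 k2 d h h' * x $ h')"
    using h by (simp add: sum_subtractf mult.assoc of_bool_def if_distrib[of "\<lambda>c. c * _"]
        if_distrib[of "\<lambda>c. _ * c"] cong: if_cong)
  finally show ?thesis .
qed

lemma dual_eigenvector:
  assumes z: "z \<in># dual_eigenvalues r d"
  obtains x where "x \<in> carrier_vec r" "x \<noteq> 0\<^sub>v r"
    "\<And>h. h < r \<Longrightarrow> (\<Sum>h'<r. replicate_gram k1 k2 d h h' * x $ h') = (real r - z) * x $ h"
proof -
  have "char_poly (dual_information_mat k1 k2 r d) \<noteq> 0"
    using degree_monic_char_poly[OF dual_information_mat_carrier[of k1 k2 r d]] by auto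
  then have "poly (char_poly (dual_information_mat k1 k2 r d)) z = 0"
    using z by (simp add: dual_eigenvalues_def)
  then obtain x where x: "x \<in> carrier_vec r" "x \<noteq> 0\<^sub>v r"
      "dual_information_mat k1 k2 r d *\<^sub>v x = z \<cdot>\<^sub>v x"
    using eigenvalue_root_char_poly[OF dual_information_mat_carrier[of k1 k2 r d]]
    by (auto simp: eigenvalue_def eigenvector_def)
  have "(\<Sum>h'<r. replicate_gram k1 k2 d h h' * x $ h') = (real r - z) * x $ h" if "h < r" for h
    using arg_cong[OF x(3), of "\<lambda>w. w $ h"] dual_mult_vec[OF x(1) that, of d] x(1) that
    by (simp add: algebra_simps)
  then show ?thesis using that x by blast
qed

lemma gram_form_eq_square_sum:
  "(\<Sum>h<r. x h * (\<Sum>h'<r. replicate_gram k1 k2 d h h' * x h')) =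
   \<kappa> * (\<Sum>t<v. (\<Sum>h<r. x h * u d h t)\<^sup>2)"
proof -
  have "(\<Sum>h<r. x h * (\<Sum>h'<r. replicate_gram k1 k2 d h h' * x h')) =
      (\<Sum>h<r. \<Sum>h'<r. \<Sum>t<v. \<kappa> * (x h * u d h t * (x h' * u d h' t)))"
    unfolding replicate_gram_def sum_distrib_left sum_distrib_right
    by (intro sum.cong refl) (simp add: mult_ac)
  also have "\<dots> = (\<Sum>h<r. \<Sum>t<v. \<Sum>h'<r. \<kappa> * (x h * u d h t * (x h' * u d h' t)))"
    by (intro sum.cong refl sum.swap)
  also have "\<dots> = (\<Sum>t<v. \<Sum>h<r. \<Sum>h'<r. \<kappa> * (x h * u d h t * (x h' * u d h' t)))"
    by (rule sum.swap)
  also have "\<dots> = \<kappa> * (\<Sum>t<v. (\<Sum>h<r. x h * u d h t)\<^sup>2)"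
    unfolding power2_eq_square sum_product by (simp only: sum_distrib_left)
  finally show ?thesis .
qed

text \<open>This ties the eigenvalues of the dual matrix to geometry: up to the factor \<open>\<kappa>\<close>, the deficit
  \<open>r - z\<close> is the squared length of the combination of the centred indicators whose coefficients
  form a unit eigenvector.\<close>
lemma dual_eigenvalue_combination:
  assumes x: "\<And>h. h < r \<Longrightarrow> (\<Sum>h'<r. replicate_gram k1 k2 d h h' * x h') = (real r - z) * x h"
  shows "(real r - z) * (\<Sum>h<r. (x h)\<^sup>2) = \<kappa> * (\<Sum>t<v. (\<Sum>h<r. x h * u d h t)\<^sup>2)"
proof -
  have "(real r - z) * (\<Sum>h<r. (x h)\<^sup>2) =
      (\<Sum>h<r. x h * (\<Sum>h'<r. replicate_gram k1 k2 d h h' * x h'))"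
    using x by (simp add: sum_distrib_left power2_eq_square mult_ac)
  then show ?thesis unfolding gram_form_eq_square_sum .
qed

lemma sum_squares_pos:
  fixes x :: "real vec"
  assumes "x \<in> carrier_vec n" "x \<noteq> 0\<^sub>v n"
  shows "0 < (\<Sum>h<n. (x $ h)\<^sup>2)"
proof -
  obtain h where "h < n" "x $ h \<noteq> 0"
    using assms by (metis carrier_vecD eq_vecI index_zero_vec)
  then show ?thesis by (intro sum_pos2[of _ h]) auto
qed

lemma dual_eigenvalue_le:
  assumes "z \<in># dual_eigenvalues r d"
  shows "z \<le> real r"
proof -
  obtain x where x: "x \<in> carrier_vec r" "x \<noteq> 0\<^sub>v r"
    "\<And>h. h < r \<Longrightarrow> (\<Sum>h'<r. replicate_gram k1 k2 d h h' * x $ h') = (real r - z) * x $ h"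
    using dual_eigenvector[OF assms] by blast
  have "0 \<le> (real r - z) * (\<Sum>h<r. (x $ h)\<^sup>2)"
    using dual_eigenvalue_combination[of r d "($) x" z] x(3) by (simp add: sum_nonneg)
  then show ?thesis using sum_squares_pos[OF x(1,2)] by (simp add: zero_le_mult_iff)
qed

text \<open>The trace of the Gram matrix of \<open>r\<close> unit vectors is \<open>r\<close>, so the total of the dual eigenvalues
  is \<open>r * r - r\<close> for every design.\<close>
lemma
  assumes d: "resolvable_design k1 k2 r d"
  shows size_dual_eigenvalues: "size (dual_eigenvalues r d) = r"
    and sum_dual_eigenvalues: "\<Sum>\<^sub># (dual_eigenvalues r d) = real r * (real r - 1)"
proof -
  let ?H = "dual_information_mat k1 k2 r d"
  have "transpose_mat ?H = ?H"
    by (rule eq_matI) (auto simp: dual_information_mat_def replicate_gram_commute)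
  then obtain es where es: "char_poly ?H = (\<Prod>e\<leftarrow>es. [:- e, 1:])" "length es = r"
    using symmetric_real_char_poly_splits[OF dual_information_mat_carrier[of k1 k2 r d]] by blast
  have "proots (\<Prod>e\<leftarrow>es. [:- e, 1:]) = mset es"
  proof (induction es)
    case (Cons e es)
    have "(\<Prod>e\<leftarrow>es. [:- e, 1:]) \<noteq> 0" by (auto simp: prod_list_zero_iff)
    then show ?case using Cons
      by (simp add: proots_mult del: mult_pCons_left mult_pCons_right)
  qed simp
  then have D: "dual_eigenvalues r d = mset es" by (simp add: dual_eigenvalues_def es)
  show "size (dual_eigenvalues r d) = r" unfolding D using es by simp
  have "sum_list es = (\<Sum>h<r. ?H $$ (h, h))"
    using trace_eq_sum_eigenvalues[OF dual_information_mat_carrier es(1)] by simp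
  also have "\<dots> = (\<Sum>h<r. real r - 1)"
    using d by (intro sum.cong) (auto simp: dual_information_mat_def replicate_gram_self resolvable_design_def)
  finally show "\<Sum>\<^sub># (dual_eigenvalues r d) = real r * (real r - 1)"
    unfolding D by (simp add: sum_mset_sum_list)
qed

text \<open>Any \<open>r - 1\<close> of the \<open>r\<close> eigenvalues contribute at most \<open>r\<close>
  each to the total \<open>r * (r - 1)\<close>, so the remaining one cannot be negative.\<close>
lemma dual_eigenvalue_nonneg:
  assumes d: "resolvable_design k1 k2 r d" and z: "z \<in># dual_eigenvalues r d"
  shows "0 \<le> z"
proof -
  obtain N where N: "dual_eigenvalues r d = add_mset z N" using multi_member_split[OF z] by blast
  have size: "real (size N) = real r - 1" using size_dual_eigenvalues[OF d] N by (simp flip: of_nat_Suc)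
  have "\<Sum>\<^sub># N \<le> (\<Sum>x\<in>#N. real r)"
    using sum_mset_mono[of N "\<lambda>x. x" "\<lambda>x. real r"] dual_eigenvalue_le[of _ r d] by (simp add: N)
  then have "\<Sum>\<^sub># N \<le> real r * (real r - 1)" using size by (simp add: mult.commute)
  then show ?thesis using sum_dual_eigenvalues[OF d] N by simp
qed

text \<open>If \<open>x\<close> is in the kernel of the dual matrix, then the combination \<open>y\<close> of the centred indicators
  with coefficients \<open>x\<close> is in the kernel of the information matrix, and so is the all-ones vector,
  which is orthogonal to \<open>y\<close>.  In a connected design this kernel is a line, so \<open>y = 0\<close>; but the
  squared length of \<open>y\<close> is a positive multiple of that of \<open>x\<close>.\<close>
lemma dual_eigenvalue_nonzero:
  assumes d: "d \<in> designs k1 k2 r" and r: "0 < r"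
  shows "0 \<notin># dual_eigenvalues r d"
proof
  assume "0 \<in># dual_eigenvalues r d"
  then obtain x where x: "x \<in> carrier_vec r" "x \<noteq> 0\<^sub>v r"
    "\<And>h. h < r \<Longrightarrow> (\<Sum>h'<r. replicate_gram k1 k2 d h h' * x $ h') = (real r - 0) * x $ h"
    using dual_eigenvector by blast
  have res: "resolvable_design k1 k2 r d" and conn: "connected_design k1 k2 r d"
    using d by (auto simp: designs_def)
  let ?C = "information_mat k1 k2 r d"
  define y where "y t = (\<Sum>h<r. x $ h * u d h t)" for t
  have u0: "(\<Sum>t<v. u d h t) = 0" if "h < r" for h
    using that res by (intro sum_centred_indicator) (simp add: resolvable_design_def)
  have y_sum: "(\<Sum>t<v. y t) = 0"
    unfolding y_def by (subst sum.swap) (simp add: u0 flip: sum_distrib_left)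
  have uy: "\<kappa> * (\<Sum>t<v. u d h t * y t) = real r * x $ h" if "h < r" for h
  proof -
    have "\<kappa> * (\<Sum>t<v. u d h t * y t) = (\<Sum>h'<r. replicate_gram k1 k2 d h h' * x $ h')"
      unfolding y_def replicate_gram_def sum_distrib_left sum_distrib_right
      by (subst sum.swap) (simp add: mult_ac)
    then show ?thesis using x(3)[OF that] by simp
  qed
  \<comment> \<open>The action of \<open>r I - r J / v - \<kappa> \<Sum>h. u_h u_h'\<close> on an arbitrary vector.\<close>
  have mult: "(?C *\<^sub>v vec v w) $ s = real r * w s - real r / real v * (\<Sum>t<v. w t)
      - (\<Sum>h<r. u d h s * (\<kappa> * (\<Sum>t<v. u d h t * w t)))" if s: "s < v" for w s
  proof -
    have "(?C *\<^sub>v vec v w) $ s = (\<Sum>t<v. ?C $$ (s, t) * w t)"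
      using s by (simp add: scalar_prod_def lessThan_atLeast0 del: of_nat_add)
    also have "\<dots> = (\<Sum>t<v. real r * (of_bool (s = t) * w t) - real r / real v * w t
        - (\<Sum>h<r. u d h s * (\<kappa> * (u d h t * w t))))"
      using s by (intro sum.cong refl)
        (simp add: information_mat_entry[OF res] algebra_simps sum_distrib_left sum_distrib_right
          del: of_nat_add)
    also have "\<dots> = real r * w s - real r / real v * (\<Sum>t<v. w t)
        - (\<Sum>t<v. \<Sum>h<r. u d h s * (\<kappa> * (u d h t * w t)))"
      using s by (simp add: sum_subtractf of_bool_def if_distrib[of "\<lambda>c. c * _"] cong: if_cong
          flip: sum_distrib_left del: of_nat_add times_divide_eq_left)
    also have "(\<Sum>t<v. \<Sum>h<r. u d h s * (\<kappa> * (u d h t * w t))) =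
        (\<Sum>h<r. u d h s * (\<kappa> * (\<Sum>t<v. u d h t * w t)))"
      by (subst sum.swap) (simp only: sum_distrib_left)
    finally show ?thesis .
  qed
  have v0: "0 < v" using k1_pos by simp
  have one: "?C *\<^sub>v vec v (\<lambda>_. 1) = 0\<^sub>v v"
  proof (rule eq_vecI)
    fix s assume "s < dim_vec (0\<^sub>v v :: real vec)"
    then have s: "s < v" by simp
    show "(?C *\<^sub>v vec v (\<lambda>_. 1)) $ s = 0\<^sub>v v $ s"
      unfolding mult[OF s] using s u0 v0 by (simp del: of_nat_add)
  qed simp
  have ker: "?C *\<^sub>v vec v y = 0\<^sub>v v"
  proof (rule eq_vecI)
    fix s assume "s < dim_vec (0\<^sub>v v :: real vec)"
    then have s: "s < v" by simp
    have "(\<Sum>h<r. u d h s * (\<kappa> * (\<Sum>t<v. u d h t * y t))) = (\<Sum>h<r. u d h s * (real r * x $ h))"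
      using uy by (intro sum.cong refl) simp
    also have "\<dots> = real r * y s" by (simp add: y_def sum_distrib_left mult_ac)
    finally have "(\<Sum>h<r. u d h s * (\<kappa> * (\<Sum>t<v. u d h t * y t))) = real r * y s" .
    then show "(?C *\<^sub>v vec v y) $ s = 0\<^sub>v v $ s"
      unfolding mult[OF s] using s y_sum by simp
  qed simp
  have "vec v (\<lambda>_. 1 :: real) \<noteq> 0\<^sub>v v"
  proof
    assume "vec v (\<lambda>_. 1 :: real) = 0\<^sub>v v"
    from arg_cong[OF this, of "\<lambda>w. w $ 0"] v0 show False by simp
  qed
  moreover have "scalar_prod (vec v (\<lambda>_. 1)) (vec v y) = 0"
    using y_sum by (simp add: scalar_prod_def lessThan_atLeast0)
  ultimately have "vec v y = 0\<^sub>v v"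
    using rank_eq_pred_imp_kernel_line[OF information_mat_carrier transpose_information_mat[OF res] _ v0 _ one _ _ ker]
      conn by (simp add: connected_design_def)
  then have "y t = 0" if "t < v" for t
    using that by (metis index_vec index_zero_vec(1))
  then have "real r * (\<Sum>h<r. (x $ h)\<^sup>2) = 0"
    using dual_eigenvalue_combination[of r d "($) x" 0] x(3) by (simp add: y_def)
  then show False using sum_squares_pos[OF x(1,2)] r by simp
qed

lemma dual_eigenvalue_pos:
  assumes d: "d \<in> designs k1 k2 r" and r: "0 < r" and z: "z \<in># dual_eigenvalues r d"
  shows "0 < z"
proof -
  have "z \<noteq> 0" using dual_eigenvalue_nonzero[OF d r] z by metis
  then show ?thesis using dual_eigenvalue_nonneg[OF _ z] d by (auto simp: designs_def)
qed

text \<open>Here the Gram matrix is \<open>(1 - c) I + c J\<close>.  An eigenvector of the dual matrix is constant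
  unless its eigenvalue is \<open>r - 1 + c\<close>, which leaves two possible eigenvalues.  Their
  multiplicities follow from the total \<open>r * (r - 1)\<close>, because the two values differ.\<close>
lemma ECD_dual_eigenvalues:
  fixes c :: real
  assumes d: "resolvable_design k1 k2 r d" and r: "0 < r"
    and G: "\<And>h h'. h < r \<Longrightarrow> h' < r \<Longrightarrow> h \<noteq> h' \<Longrightarrow> replicate_gram k1 k2 d h h' = c"
    and c: "c \<noteq> 0"
  shows "dual_eigenvalues r d =
    add_mset ((real r - 1) * (1 - c)) (replicate_mset (r - 1) (real r - 1 + c))"
proof -
  define p q where "p = (real r - 1) * (1 - c)" and "q = real r - 1 + c"
  have qp: "q - p = real r * c" by (simp add: p_def q_def algebra_simps)
  let ?Z = "dual_eigenvalues r d"
  have two: "z = p \<or> z = q" if z: "z \<in># ?Z" for z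
  proof (rule ccontr)
    assume "\<not> ?thesis"
    then have neq: "q - z \<noteq> 0" "z \<noteq> p" by auto
    obtain x where x: "x \<in> carrier_vec r" "x \<noteq> 0\<^sub>v r"
      "\<And>h. h < r \<Longrightarrow> (\<Sum>h'<r. replicate_gram k1 k2 d h h' * x $ h') = (real r - z) * x $ h"
      using dual_eigenvector[OF z] by blast
    define S where "S = (\<Sum>h<r. x $ h)"
    have row: "(q - z) * x $ h = c * S" if h: "h < r" for h
    proof -
      have "replicate_gram k1 k2 d h h' * x $ h' = c * x $ h' + (if h' = h then (1 - c) * x $ h else 0)"
        if "h' < r" for h'
        using G[OF h that] replicate_gram_self[of d h] d h
        by (auto simp: resolvable_design_def algebra_simps)
      then have "(\<Sum>h'<r. replicate_gram k1 k2 d h h' * x $ h') = c * S + (1 - c) * x $ h"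
        using h by (simp add: S_def sum.distrib sum_distrib_left)
      then show ?thesis using x(3)[OF h] by (simp add: q_def algebra_simps)
    qed
    \<comment> \<open>Adding up the rows leaves an equation for the coordinate sum alone, since \<open>q - p = r c\<close>.\<close>
    have "(q - z) * S = real r * c * S"
      unfolding S_def sum_distrib_left using row by (simp add: S_def sum_distrib_left mult.assoc)
    then have "(p - z) * S = 0" using qp by (simp add: algebra_simps)
    then have "S = 0" using neq by simp
    then have "\<forall>h<r. x $ h = 0" using row neq by auto
    then show False using x(1,2) by (metis carrier_vecD eq_vecI index_zero_vec)
  qed
  define m where "m = count ?Z p"
  have "p \<noteq> q" using qp c r by auto
  have Z: "?Z = replicate_mset m p + replicate_mset (size ?Z - m) q"
  proof -
    have "?Z = filter_mset (\<lambda>z. z = p) ?Z + filter_mset (\<lambda>z. z \<noteq> p) ?Z" by simp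
    moreover have "filter_mset (\<lambda>z. z = p) ?Z = replicate_mset m p" by (simp add: m_def filter_eq_replicate_mset)
    moreover have "filter_mset (\<lambda>z. z \<noteq> p) ?Z = replicate_mset (size (filter_mset (\<lambda>z. z \<noteq> p) ?Z)) q"
      using two by (intro set_mset_subset_singletonD) auto
    ultimately show ?thesis by (metis add_diff_cancel_left' size_replicate_mset size_union)
  qed
  have size: "size ?Z = r" by (rule size_dual_eigenvalues[OF d])
  have m: "m \<le> r" using size count_le_size[of ?Z p] by (simp add: m_def)
  have "real r * (real r - 1) = real m * p + (real r - real m) * q"
    using sum_dual_eigenvalues[OF d] m by (subst (asm) Z) (simp add: size of_nat_diff)
  then have "real m * (q - p) = real r * c" by (simp add: q_def algebra_simps)
  then have "m = 1" using qp c r by simp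
  then show ?thesis using Z by (simp add: size p_def q_def)
qed

section \<open>Comparison of designs\<close>

lemma filter_eigenvalue_mset:
  assumes d: "d \<in> designs k1 k2 r" and r: "0 < r" "r < v"
  shows "filter_mset (\<lambda>x. x \<noteq> 0) (eigenvalue_mset k1 k2 r d) =
    dual_eigenvalues r d + replicate_mset (v - 1 - r) (real r)"
proof -
  have "\<forall>x \<in># dual_eigenvalues r d + replicate_mset (v - 1 - r) (real r). x \<noteq> 0"
    using dual_eigenvalue_nonzero[OF d r(1)] r by (auto split: if_splits)
  then have "filter_mset (\<lambda>x. x \<noteq> 0) (dual_eigenvalues r d + replicate_mset (v - 1 - r) (real r)) =
      dual_eigenvalues r d + replicate_mset (v - 1 - r) (real r)"
    by (subst filter_mset_eq_conv) simp
  moreover have "resolvable_design k1 k2 r d" using d by (simp add: designs_def)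
  ultimately show ?thesis using eigenvalue_mset_eq[of r d] r by simp
qed

lemma psi_eq:
  assumes d: "d \<in> designs k1 k2 r" and r: "0 < r" "r < v"
  shows "psi k1 k2 r f d =
    (\<Sum>x\<in>#dual_eigenvalues r d. f x) + real (v - 1 - r) * f (real r)"
proof -
  define zs where "zs = sorted_list_of_multiset (filter_mset (\<lambda>x. x \<noteq> 0) (eigenvalue_mset k1 k2 r d))"
  have mset: "mset zs = dual_eigenvalues r d + replicate_mset (v - 1 - r) (real r)"
    by (simp add: zs_def filter_eigenvalue_mset[OF assms])
  have "resolvable_design k1 k2 r d" using d by (simp add: designs_def)
  then have len: "length zs = v - 1"
    using arg_cong[OF mset, of size] r by (simp add: size_dual_eigenvalues)
  have "psi k1 k2 r f d = (\<Sum>i = 1..v - 1. f (zs ! (i - 1)))"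
    by (simp add: psi_def nz_eig_def zs_def)
  also have "\<dots> = (\<Sum>i<v - 1. f (zs ! i))"
    by (rule sum.reindex_bij_witness[of _ Suc "\<lambda>i. i - 1"]) auto
  also have "\<dots> = sum_list (map f zs)"
    by (simp add: sum_list_sum_nth len lessThan_atLeast0)
  also have "\<dots> = (\<Sum>x\<in>#mset zs. f x)"
    by (metis mset_map sum_mset_sum_list)
  finally show ?thesis unfolding mset by simp
qed

text \<open>The additional eigenvalues \<open>r\<close> do not affect the minimum, since no dual eigenvalue exceeds
  \<open>r\<close>.\<close>
lemma nz_eig_1_eqI:
  assumes d: "d \<in> designs k1 k2 r" and r: "0 < r" "r < v"
    and z: "z \<in># dual_eigenvalues r d" "\<And>x. x \<in># dual_eigenvalues r d \<Longrightarrow> z \<le> x"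
  shows "nz_eig k1 k2 r d 1 = z"
proof -
  define M where "M = dual_eigenvalues r d + replicate_mset (v - 1 - r) (real r)"
  have zM: "z \<in># M" using z by (simp add: M_def)
  have least: "z \<le> x" if "x \<in># M" for x
    using that z dual_eigenvalue_le[OF z(1)] by (auto simp: M_def split: if_splits)
  obtain x xs where xs: "sorted_list_of_multiset M = x # xs"
    using zM by (cases "sorted_list_of_multiset M") (auto simp flip: set_sorted_list_of_multiset)
  have "x \<in># M" using xs by (simp flip: set_sorted_list_of_multiset)
  moreover have "x \<le> z"
    using sorted_sorted_list_of_multiset[of M] zM xs by (auto simp flip: set_sorted_list_of_multiset)
  ultimately have "x = z" using least by force
  then show ?thesis
    unfolding nz_eig_def filter_eigenvalue_mset[OF d r] M_def[symmetric] xs by simp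
qed

lemma dual_eigenvalues_split_least:
  assumes d: "d \<in> designs k1 k2 r" and r: "0 < r" "r < v"
  obtains N where "dual_eigenvalues r d = add_mset (nz_eig k1 k2 r d 1) N"
proof -
  let ?Z = "dual_eigenvalues r d"
  have "resolvable_design k1 k2 r d" using d by (simp add: designs_def)
  then have "?Z \<noteq> {#}" using size_dual_eigenvalues r by force
  then have "Min (set_mset ?Z) \<in># ?Z" by (intro Min_in) auto
  moreover from this have "nz_eig k1 k2 r d 1 = Min (set_mset ?Z)"
    by (intro nz_eig_1_eqI[OF assms]) auto
  ultimately show ?thesis using that multi_member_split by metis
qed

lemma nz_eig_1_pos:
  assumes "d \<in> designs k1 k2 r" "0 < r" "r < v"
  shows "0 < nz_eig k1 k2 r d 1"
  using dual_eigenvalues_split_least[OF assms] dual_eigenvalue_pos[OF assms(1,2)]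
  by (metis union_single_eq_member)

text \<open>The convex function \<open>max 0 (a - x)\<close>, where \<open>a\<close> is the least non-zero eigenvalue of \<open>d'\<close>,
  sums to zero over the spectrum of \<open>d'\<close>; it can sum to zero over that of \<open>d\<close> only if no
  eigenvalue there is below \<open>a\<close>.\<close>
lemma psi_le_imp_nz_eig_1_ge:
  assumes d: "d \<in> designs k1 k2 r" "d' \<in> designs k1 k2 r" and r: "0 < r" "r < v"
    and le: "\<And>f. convex_on {0<..} f \<Longrightarrow> psi k1 k2 r f d \<le> psi k1 k2 r f d'"
  shows "nz_eig k1 k2 r d' 1 \<le> nz_eig k1 k2 r d 1"
proof (rule ccontr)
  define a where "a = nz_eig k1 k2 r d' 1"
  assume "\<not> ?thesis"
  then have less: "nz_eig k1 k2 r d 1 < a" by (simp add: a_def)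
  let ?f = "\<lambda>x::real. max 0 (a - x)"
  have "convex_on {0<..} ?f"
  proof (rule convex_onI)
    fix t x y :: real assume t: "0 < t" "t < 1"
    have "a - ((1 - t) * x + t * y) = (1 - t) * (a - x) + t * (a - y)" by (simp add: algebra_simps)
    also have "\<dots> \<le> (1 - t) * max 0 (a - x) + t * max 0 (a - y)"
      using t by (intro add_mono mult_left_mono) auto
    finally show "max 0 (a - ((1 - t) *\<^sub>R x + t *\<^sub>R y)) \<le> (1 - t) * max 0 (a - x) + t * max 0 (a - y)"
      using t by simp
  qed simp
  then have psi: "psi k1 k2 r ?f d \<le> psi k1 k2 r ?f d'" by (rule le)
  obtain N where N: "dual_eigenvalues r d = add_mset (nz_eig k1 k2 r d 1) N"
    using dual_eigenvalues_split_least[OF d(1) r] by blast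
  have "a \<le> x" if "x \<in># dual_eigenvalues r d'" for x
  proof -
    have "Min (set_mset (dual_eigenvalues r d')) \<in># dual_eigenvalues r d'"
      using that by (intro Min_in) auto
    then have "a = Min (set_mset (dual_eigenvalues r d'))"
      unfolding a_def by (intro nz_eig_1_eqI[OF d(2) r]) auto
    then show ?thesis using that by simp
  qed
  then have "(\<Sum>x\<in>#dual_eigenvalues r d'. ?f x) = 0"
    by (subst sum_mset.neutral) auto
  moreover have "0 \<le> (\<Sum>x\<in>#N. ?f x)" by (induction N) auto
  ultimately show False
    using psi less unfolding psi_eq[OF d(1) r] psi_eq[OF d(2) r] N by simp
qed

lemma mult_theta_bar_less: "(real k1)\<^sup>2 < real v * real (theta_bar k1 k2 + 1)"
proof -
  let ?y = "real (k1\<^sup>2) / real v"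
  have "?y < real_of_int (\<lfloor>?y\<rfloor> + 1)" using floor_correct[of ?y] by simp
  moreover have "real (theta_bar k1 k2) = real_of_int \<lfloor>?y\<rfloor>"
    by (simp add: theta_bar_def del: of_nat_add of_nat_power)
  moreover have "real (theta_bar k1 k2 + 1) = real (theta_bar k1 k2) + 1" by simp
  ultimately have "?y < real (theta_bar k1 k2 + 1)" by linarith
  moreover have "0 < real v" using k1_pos by simp
  ultimately show ?thesis by (simp add: pos_divide_less_eq mult.commute del: of_nat_add)
qed

text \<open>For concurrence \<open>theta_bar k1 k2 + 1\<close> the off-diagonal Gram entry \<open>c\<close> is positive, so the
  simple eigenvalue \<open>(r - 1) * (1 - c)\<close> lies below the multiple one \<open>r - 1 + c\<close>.  For a smaller
  constant concurrence the order can be reversed, and then the comparison of sums in the lemma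
  on convex functions would not apply.\<close>
lemma ECD_theta_bar_spectrum:
  assumes d: "d \<in> designs k1 k2 r" and r: "2 \<le> r" "r < v"
    and ecd: "ECD r (theta_bar k1 k2 + 1) d"
  obtains q where "nz_eig k1 k2 r d 1 \<le> q"
    and "dual_eigenvalues r d = add_mset (nz_eig k1 k2 r d 1) (replicate_mset (r - 1) q)"
proof -
  define c where "c = (real v * real (theta_bar k1 k2 + 1) - (real k1)\<^sup>2) / (real k1 * real k2)"
  define p q where "p = (real r - 1) * (1 - c)" and "q = real r - 1 + c"
  have c: "0 < c" unfolding c_def using mult_theta_bar_less k1_pos k2_pos by simp
  have res: "resolvable_design k1 k2 r d" using d by (simp add: designs_def)
  have "replicate_gram k1 k2 d h h' = c" if "h < r" "h' < r" "h \<noteq> h'" for h h'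
    using that res ecd replicate_gram_eq_concurrence[of d h h']
    by (simp add: resolvable_design_def ECD_def c_def)
  then have Z: "dual_eigenvalues r d = add_mset p (replicate_mset (r - 1) q)"
    using ECD_dual_eigenvalues[OF res _ _ , of c] c r by (simp add: p_def q_def)
  have "q - p = real r * c" by (simp add: p_def q_def algebra_simps)
  then have pq: "p \<le> q" using c by (smt (verit) mult_nonneg_nonneg of_nat_0_le_iff)
  have "nz_eig k1 k2 r d 1 = p"
    using r pq by (intro nz_eig_1_eqI[OF d]) (auto simp: Z)
  then show ?thesis using that Z pq by simp
qed

text \<open>The spectra of both designs consist of \<open>r\<close> dual eigenvalues with the same total and of the same
  number of eigenvalues \<open>r\<close>, so the two inequalities on sums apply to the dual eigenvalues.\<close>
lemma ECD_psi_le: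
  assumes dbar: "dbar \<in> designs k1 k2 r" and r: "2 \<le> r" "r < v"
    and ecd: "ECD r (theta_bar k1 k2 + 1) dbar"
    and d: "d \<in> designs k1 k2 r" and le: "nz_eig k1 k2 r d 1 \<le> nz_eig k1 k2 r dbar 1"
  shows "convex_on {0<..} f \<Longrightarrow> psi k1 k2 r f dbar \<le> psi k1 k2 r f d"
    and "eigenvalue_mset k1 k2 r d \<noteq> eigenvalue_mset k1 k2 r dbar \<Longrightarrow>
      psi k1 k2 r (\<lambda>x. x\<^sup>2) dbar < psi k1 k2 r (\<lambda>x. x\<^sup>2) d"
proof -
  have r0: "0 < r" using r by simp
  have res: "resolvable_design k1 k2 r d" "resolvable_design k1 k2 r dbar"
    using d dbar by (simp_all add: designs_def)
  define p z where "p = nz_eig k1 k2 r dbar 1" and "z = nz_eig k1 k2 r d 1"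
  obtain q where pq: "p \<le> q" and Zbar: "dual_eigenvalues r dbar = add_mset p (replicate_mset (r - 1) q)"
    using ECD_theta_bar_spectrum[OF dbar r ecd] unfolding p_def by blast
  obtain N where Z: "dual_eigenvalues r d = add_mset z N"
    using dual_eigenvalues_split_least[OF d r0 r(2)] unfolding z_def by blast
  have size: "size N = r - 1" using size_dual_eigenvalues[OF res(1)] Z by simp
  have sum: "z + \<Sum>\<^sub># N = p + real (size N) * q"
    using sum_dual_eigenvalues[OF res(1)] sum_dual_eigenvalues[OF res(2)] by (simp add: Z Zbar size)
  have z: "0 < z" "z \<le> p"
    using nz_eig_1_pos[OF d r0 r(2)] le by (simp_all add: z_def p_def)
  have N: "0 < x" if "x \<in># N" for x
    using dual_eigenvalue_pos[OF d r0, of x] that Z by simp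
  note psis = psi_eq[OF d r0 r(2)] psi_eq[OF dbar r0 r(2)]
  show "psi k1 k2 r f dbar \<le> psi k1 k2 r f d" if "convex_on {0<..} f"
    using convex_sum_mset_le_of_lower_least[OF that z pq N sum] by (simp add: psis Z Zbar size)
  show "psi k1 k2 r (\<lambda>x. x\<^sup>2) dbar < psi k1 k2 r (\<lambda>x. x\<^sup>2) d"
    if neq: "eigenvalue_mset k1 k2 r d \<noteq> eigenvalue_mset k1 k2 r dbar"
  proof -
    have "dual_eigenvalues r d \<noteq> dual_eigenvalues r dbar"
      using neq eigenvalue_mset_eq[OF res(1) r(2)] eigenvalue_mset_eq[OF res(2) r(2)] by auto
    then show ?thesis
      using square_sum_mset_less_of_lower_least[OF z(2) pq sum] by (simp add: psis Z Zbar size)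
  qed
qed

end

theorem theorem7:
  fixes k1 k2 r :: nat and dbar :: design
  assumes "k2 \<ge> 2" and "k1 \<ge> k2"
    and "2 \<le> r" and "r \<le> k1 + k2 - 1"
    and "dbar \<in> designs k1 k2 r"
    and "ECD r (theta_bar k1 k2 + 1) dbar"
  shows "(\<forall>d \<in> designs k1 k2 r. eigenvalue_mset k1 k2 r d \<noteq> eigenvalue_mset k1 k2 r dbar \<longrightarrow>
            (Schur_better k1 k2 r dbar d \<longleftrightarrow>
               E_equivalent k1 k2 r dbar d \<or> E_better k1 k2 r dbar d) \<and>
            (E_equivalent k1 k2 r dbar d \<or> E_better k1 k2 r dbar d \<longleftrightarrow>
               nz_eig k1 k2 r dbar 1 \<ge> nz_eig k1 k2 r d 1)) \<and>
         (Schur_optimal k1 k2 r dbar \<longleftrightarrow> E_optimal k1 k2 r dbar)"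
proof -
  interpret positive_sizes k1 k2 using assms(1,2) by unfold_locales auto
  have r: "0 < r" "r < k1 + k2" using assms by auto
  note dbar = assms(5)
  note ecd = ECD_psi_le[OF dbar assms(3) r(2) assms(6)]
  have E: "E_equivalent k1 k2 r dbar d \<or> E_better k1 k2 r dbar d \<longleftrightarrow>
      nz_eig k1 k2 r d 1 \<le> nz_eig k1 k2 r dbar 1" if "d \<in> designs k1 k2 r" for d
    using nz_eig_1_pos[OF dbar r] nz_eig_1_pos[OF that r]
    by (auto simp: E_equivalent_def E_better_def E_criterion_def field_simps)
  have square: "convex_on {0<..} (\<lambda>x::real. x\<^sup>2)"
    using convex_power2 by (rule convex_on_subset) auto
  have "Schur_better k1 k2 r dbar d \<longleftrightarrow> nz_eig k1 k2 r d 1 \<le> nz_eig k1 k2 r dbar 1"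
    if d: "d \<in> designs k1 k2 r" "eigenvalue_mset k1 k2 r d \<noteq> eigenvalue_mset k1 k2 r dbar" for d
    using psi_le_imp_nz_eig_1_ge[OF dbar d(1) r] ecd[OF d(1)] d(2) square
    unfolding Schur_better_def by blast
  moreover have "Schur_optimal k1 k2 r dbar \<longleftrightarrow> E_optimal k1 k2 r dbar"
    using psi_le_imp_nz_eig_1_ge[OF dbar _ r] ecd(1) dbar
    unfolding Schur_optimal_def E_optimal_def by blast
  ultimately show ?thesis using E by blast
qed

end
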